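(* Let $p\ge3$ be a prime, $q\ge1$ an integer, $\theta=p^N$ with $N\ge1$, and let $f(x)=\left(\frac{\theta x+q}{x+\theta+q-1}\right)^2$. Let $|q|_p<1$ and $|\theta|_p\le|q|_p^2$. Then $$A(x_1)\supset\{x\in\mathbb{Q}_p:|x|_p\ne1\}\cup\{x\in S_1(0):|x-1|_p>|q|_p\}\cup J\big(B_{|q|_p^2,|q|_p}(x_0)\big)\cup J\big(B_{|q|_p^2,|q|_p}(x_2)\big).$$
   Context: $|\cdot|_p$ is the $p$-adic absolute value. The fixed points of $f$ in $\mathbb{Q}_p$ are $x_0=1$ and the roots $x_1,x_2\in\mathbb{Q}_p$ of $x^2+(2\theta-\theta^2+2q-1)x+q^2=0$, labelled so that $|x_1|_p=|q|_p^2$ and $|x_2|_p=1$ (they exist in $\mathbb{Q}_p$ under these hypotheses). $A(x_1)=\{y\in\mathbb{Q}_p: f^n(y)\to x_1,\ n\to\infty\}$ is the basin of attraction, where $f^n$ is the $n$-fold iterate (iterates required to be defined, i.e. never hitting the pole $1-\theta-q$). $S_r(a)=\{x\in\mathbb{Q}_p:|x-a|_p=r\}$, $B_{r,s}(a)=\{x\in\mathbb{Q}_p:r<|x-a|_p<s\}$. For $B\subset\mathbb{Q}_p$, $J(B)=\{x\in S_1(0): f^n(x)\in B\text{ for some }n\ge0\}$. *)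

theory Defs
  imports "HOL-Analysis.Analysis" "Berlekamp_Zassenhaus.Finite_Field"
begin

section \<open>The p-adic absolute value on the rationals\<close>

definition rat_padic_abs :: "nat \<Rightarrow> rat \<Rightarrow> real" where
  "rat_padic_abs p r = (if r = 0 then 0 else
     real p powi (int (multiplicity (int p) (snd (quotient_of r)))
                - int (multiplicity (int p) (fst (quotient_of r)))))"

lemma rat_padic_abs_0 [simp]: "rat_padic_abs p 0 = 0"
  by (simp add: rat_padic_abs_def)

lemma rat_padic_abs_Fract:
  assumes p: "prime p" and a: "a \<noteq> 0" and b: "b \<noteq> 0"
  shows "rat_padic_abs p (Rat.Fract a b) =
    real p powi (int (multiplicity (int p) b) - int (multiplicity (int p) a))"
proof -
  have pe: "prime_elem (int p)"
    using p by simp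
  obtain c d where cd: "quotient_of (Rat.Fract a b) = (c, d)"
    by (cases "quotient_of (Rat.Fract a b)") auto
  have d: "d > 0" using quotient_of_denom_pos[OF cd] .
  have eq: "Rat.Fract a b = Rat.Fract c d"
    using quotient_of_div[OF cd] by (simp add: Fract_of_int_quotient)
  then have cross: "a * d = c * b"
    using b d by (simp add: eq_rat)
  then have c: "c \<noteq> 0" using a d by auto
  have "multiplicity (int p) (a * d) = multiplicity (int p) (c * b)"
    using cross by simp
  then have "multiplicity (int p) a + multiplicity (int p) d =
      multiplicity (int p) c + multiplicity (int p) b"
    using a b c d pe by (simp add: prime_elem_multiplicity_mult_distrib)
  then have "int (multiplicity (int p) d) - int (multiplicity (int p) c) =
      int (multiplicity (int p) b) - int (multiplicity (int p) a)"
    by linarith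
  moreover have "Rat.Fract a b \<noteq> 0" using a b by (simp add: Fract_of_int_quotient)
  ultimately show ?thesis by (simp add: rat_padic_abs_def cd)
qed

lemma rat_padic_abs_eq_0 [simp]: "prime p \<Longrightarrow> rat_padic_abs p r = 0 \<longleftrightarrow> r = 0"
  using prime_gt_0_nat[of p] by (simp add: rat_padic_abs_def)

lemma rat_padic_abs_nonneg [simp]: "rat_padic_abs p r \<ge> 0"
  by (simp add: rat_padic_abs_def)

lemma rat_padic_abs_mult:
  assumes p: "prime p"
  shows "rat_padic_abs p (x * y) = rat_padic_abs p x * rat_padic_abs p y"
proof (cases "x = 0 \<or> y = 0")
  case False
  have pe: "prime_elem (int p)" using p by simp
  have p0: "real p \<noteq> 0" using prime_gt_0_nat[OF p] by simp
  obtain a b where x: "x = Rat.Fract a b" "b > 0" by (cases x) auto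
  obtain c d where y: "y = Rat.Fract c d" "d > 0" by (cases y) auto
  have nz: "a \<noteq> 0" "c \<noteq> 0"
    using False x y by (auto simp: rat_number_collapse)
  have "rat_padic_abs p (x * y) = real p powi
      (int (multiplicity (int p) (b * d)) - int (multiplicity (int p) (a * c)))"
    unfolding x y using nz x y by (simp add: rat_padic_abs_Fract[OF p])
  also have "\<dots> = real p powi
      ((int (multiplicity (int p) b) - int (multiplicity (int p) a)) +
       (int (multiplicity (int p) d) - int (multiplicity (int p) c)))"
    using nz x y by (simp add: prime_elem_multiplicity_mult_distrib[OF pe] algebra_simps)
  also have "\<dots> = rat_padic_abs p x * rat_padic_abs p y"
    unfolding x y using nz x y p0 by (simp add: rat_padic_abs_Fract[OF p] power_int_add)
  finally show ?thesis .
qed auto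

lemma rat_padic_abs_1 [simp]: "rat_padic_abs p 1 = 1"
  by (simp add: rat_padic_abs_def)

lemma rat_padic_abs_minus [simp]: "rat_padic_abs p (- x) = rat_padic_abs p x"
proof -
  have "multiplicity q (- a) = multiplicity q a" for q a :: int
    by (rule multiplicity_cong) simp
  then show ?thesis
    by (simp add: rat_padic_abs_def rat_uminus_code split: prod.splits)
qed

lemma rat_padic_abs_inverse:
  assumes p: "prime p"
  shows "rat_padic_abs p (inverse x) = inverse (rat_padic_abs p x)"
proof (cases "x = 0")
  case False
  then have "rat_padic_abs p x * rat_padic_abs p (inverse x) = 1"
    by (simp flip: rat_padic_abs_mult[OF p])
  then show ?thesis by (metis inverse_unique)
qed auto

lemma rat_padic_abs_le_1:
  assumes p: "prime p" and "rat_padic_abs p x \<le> 1"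
  obtains a b where "x = Rat.Fract a b" "b > 0" "\<not> int p dvd b"
proof (cases "x = 0")
  case True
  show ?thesis using that[of 0 1] True prime_gt_1_nat[OF p] by (auto simp: rat_number_collapse)
next
  case False
  obtain a b where ab: "x = Rat.Fract a b" "b > 0" "coprime a b" by (cases x) auto
  have a: "a \<noteq> 0" using False ab by (auto simp: rat_number_collapse)
  have "\<not> int p dvd b"
  proof
    assume pb: "int p dvd b"
    then have "\<not> int p dvd a"
      using ab(3) p by (meson not_prime_unit coprime_common_divisor prime_nat_int_transfer)
    then have "multiplicity (int p) a = 0" by (simp add: not_dvd_imp_multiplicity_0)
    moreover have "multiplicity (int p) b > 0"
      using pb ab(2) p by (simp add: prime_multiplicity_gt_zero_iff)
    moreover have "real p > 1" using prime_gt_1_nat[OF p] by simp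
    ultimately have "rat_padic_abs p x > 1"
      using a ab by (simp add: rat_padic_abs_Fract[OF p] )
    then show False using assms by simp
  qed
  with ab show ?thesis using that by blast
qed

lemma rat_padic_abs_not_dvd:
  assumes p: "prime p" and "\<not> int p dvd b"
  shows "rat_padic_abs p (Rat.Fract a b) \<le> 1"
proof (cases "a = 0")
  case False
  have "b \<noteq> 0" using assms(2) by auto
  have "real p \<ge> 1" using prime_gt_0_nat[OF p] by simp
  then have "real p ^ multiplicity (int p) a \<ge> 1" by (rule one_le_power)
  then show ?thesis
    using assms False \<open>b \<noteq> 0\<close>
    by (simp add: rat_padic_abs_Fract not_dvd_imp_multiplicity_0 power_int_minus inverse_le_1_iff)
qed (auto simp: rat_number_collapse)

lemma rat_padic_abs_add:
  assumes p: "prime p"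
  shows "rat_padic_abs p (x + y) \<le> max (rat_padic_abs p x) (rat_padic_abs p y)"
proof -
  have one: "rat_padic_abs p (z + 1) \<le> 1" if z: "rat_padic_abs p z \<le> 1" for z
  proof -
    obtain a b where ab: "z = Rat.Fract a b" "b > 0" "\<not> int p dvd b"
      using rat_padic_abs_le_1[OF p z] by blast
    then have "z + 1 = Rat.Fract (a + b) b" by (simp add: One_rat_def)
    then show ?thesis using rat_padic_abs_not_dvd[OF p ab(3)] by metis
  qed
  have main: "rat_padic_abs p (u + v) \<le> rat_padic_abs p v"
    if "rat_padic_abs p u \<le> rat_padic_abs p v" for u v
  proof (cases "v = 0")
    case True
    then show ?thesis using that p by simp
  next
    case False
    then have pos: "rat_padic_abs p v > 0"
      using p by (metis rat_padic_abs_eq_0 rat_padic_abs_nonneg less_eq_real_def)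
    have "rat_padic_abs p (u * inverse v) \<le> 1"
      unfolding rat_padic_abs_mult[OF p] rat_padic_abs_inverse[OF p]
      using that pos by (simp add: field_simps)
    from one[OF this] have "rat_padic_abs p (u * inverse v + 1) * rat_padic_abs p v
        \<le> 1 * rat_padic_abs p v"
      using pos by (intro mult_right_mono) auto
    also have "rat_padic_abs p (u * inverse v + 1) * rat_padic_abs p v = rat_padic_abs p (u + v)"
      using False by (simp add: algebra_simps flip: rat_padic_abs_mult[OF p])
    finally show ?thesis by simp
  qed
  show ?thesis
    using main[of x y] main[of y x] by (cases "rat_padic_abs p x \<le> rat_padic_abs p y")
      (auto simp: add.commute)
qed

lemma rat_padic_abs_triangle:
  assumes p: "prime p"
  shows "rat_padic_abs p (x + y) \<le> rat_padic_abs p x + rat_padic_abs p y"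
  using rat_padic_abs_add[OF p, of x y] rat_padic_abs_nonneg[of p x] rat_padic_abs_nonneg[of p y]
  by linarith

lemma rat_padic_abs_minus_commute: "rat_padic_abs p (x - y) = rat_padic_abs p (y - x)"
  using rat_padic_abs_minus[of p "x - y"] by simp

lemma rat_padic_abs_triangle3:
  assumes p: "prime p"
  shows "\<bar>rat_padic_abs p x - rat_padic_abs p y\<bar> \<le> rat_padic_abs p (x - y)"
  using rat_padic_abs_triangle[OF p, of "x - y" y] rat_padic_abs_triangle[OF p, of "y - x" x]
  by (simp add: rat_padic_abs_minus_commute[of p y x] abs_le_iff)


section \<open>The field of p-adic numbers\<close>

text \<open>
  The prime is the cardinality of the type parameter. The type below is the completion of the
  rationals, that is, Cauchy sequences modulo null sequences, for the absolute value
  \<^const>\<open>rat_padic_abs\<close> (compare the construction of the reals in HOL).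
\<close>

definition padic_null :: "nat \<Rightarrow> (nat \<Rightarrow> rat) \<Rightarrow> bool" where
  "padic_null p X \<longleftrightarrow> (\<lambda>n. rat_padic_abs p (X n)) \<longlonglongrightarrow> 0"

definition padic_cauchy :: "nat \<Rightarrow> (nat \<Rightarrow> rat) \<Rightarrow> bool" where
  "padic_cauchy p X \<longleftrightarrow> (\<forall>e>0. \<exists>M. \<forall>m\<ge>M. \<forall>n\<ge>M. rat_padic_abs p (X m - X n) < e)"

lemma padic_null_0 [simp]: "padic_null p (\<lambda>n. 0)"
  by (simp add: padic_null_def)

lemma padic_null_minus: "padic_null p X \<Longrightarrow> padic_null p (\<lambda>n. - X n)"
  by (simp add: padic_null_def)

lemma padic_null_eventually:
  assumes "eventually (\<lambda>n. rat_padic_abs p (Y n) \<le> rat_padic_abs p (X n) * c) sequentially"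
    and "padic_null p X"
  shows "padic_null p Y"
  unfolding padic_null_def
proof (rule Lim_null_comparison)
  show "(\<lambda>n. rat_padic_abs p (X n) * c) \<longlonglongrightarrow> 0"
    using tendsto_mult_right[of _ 0 sequentially c] assms(2) by (simp add: padic_null_def)
qed (use assms(1) in simp)

lemma padic_null_le:
  assumes "padic_null p X" "\<And>n. rat_padic_abs p (Y n) \<le> rat_padic_abs p (X n) * c"
  shows "padic_null p Y"
  using assms by (intro padic_null_eventually[of p Y X c]) auto

lemma padic_null_add:
  assumes p: "prime p" and X: "padic_null p X" and Y: "padic_null p Y"
  shows "padic_null p (\<lambda>n. X n + Y n)"
  unfolding padic_null_def
proof (rule Lim_null_comparison)
  show "(\<lambda>n. rat_padic_abs p (X n) + rat_padic_abs p (Y n)) \<longlonglongrightarrow> 0"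
    using tendsto_add[OF X[unfolded padic_null_def] Y[unfolded padic_null_def]] by simp
qed (simp add: rat_padic_abs_triangle[OF p])

lemma padic_cauchy_const [simp]: "padic_cauchy p (\<lambda>n. c)"
  by (simp add: padic_cauchy_def)

lemma padic_cauchy_add:
  assumes p: "prime p" and X: "padic_cauchy p X" and Y: "padic_cauchy p Y"
  shows "padic_cauchy p (\<lambda>n. X n + Y n)"
  unfolding padic_cauchy_def
proof (intro allI impI)
  fix e :: real assume "e > 0"
  then obtain M N where
    M: "\<And>m n. m \<ge> M \<Longrightarrow> n \<ge> M \<Longrightarrow> rat_padic_abs p (X m - X n) < e" and
    N: "\<And>m n. m \<ge> N \<Longrightarrow> n \<ge> N \<Longrightarrow> rat_padic_abs p (Y m - Y n) < e"
    using X Y unfolding padic_cauchy_def by metis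
  have "rat_padic_abs p (X m + Y m - (X n + Y n)) < e" if "m \<ge> max M N" "n \<ge> max M N" for m n
    using rat_padic_abs_add[OF p, of "X m - X n" "Y m - Y n"] M[of m n] N[of m n] that
    by (simp add: algebra_simps)
  then show "\<exists>K. \<forall>m\<ge>K. \<forall>n\<ge>K. rat_padic_abs p (X m + Y m - (X n + Y n)) < e"
    by blast
qed

lemma padic_cauchy_minus:
  assumes "padic_cauchy p X"
  shows "padic_cauchy p (\<lambda>n. - X n)"
proof -
  have "rat_padic_abs p (- X m - - X n) = rat_padic_abs p (X m - X n)" for m n
    using rat_padic_abs_minus[of p "X m - X n"] by simp
  then show ?thesis using assms unfolding padic_cauchy_def by simp
qed

lemma padic_cauchy_diff:
  assumes "prime p" "padic_cauchy p X" "padic_cauchy p Y"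
  shows "padic_cauchy p (\<lambda>n. X n - Y n)"
  using padic_cauchy_add[OF assms(1,2) padic_cauchy_minus[OF assms(3)]] by simp

lemma padic_cauchy_abs:
  assumes p: "prime p" and X: "padic_cauchy p X"
  shows "convergent (\<lambda>n. rat_padic_abs p (X n))"
proof (rule Cauchy_convergent, rule metric_CauchyI)
  fix e :: real assume "e > 0"
  then obtain M where M: "\<And>m n. m \<ge> M \<Longrightarrow> n \<ge> M \<Longrightarrow> rat_padic_abs p (X m - X n) < e"
    using X unfolding padic_cauchy_def by metis
  then show "\<exists>M. \<forall>m\<ge>M. \<forall>n\<ge>M. dist (rat_padic_abs p (X m)) (rat_padic_abs p (X n)) < e"
    unfolding dist_real_def
    by (meson rat_padic_abs_triangle3[OF p] order_le_less_trans)
qed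

lemma padic_cauchy_bounded:
  assumes p: "prime p" and X: "padic_cauchy p X"
  obtains b where "b > 0" "\<And>n. rat_padic_abs p (X n) \<le> b"
proof -
  have "Bseq (\<lambda>n. rat_padic_abs p (X n))"
    using padic_cauchy_abs[OF assms] by (rule convergent_imp_Bseq)
  then show ?thesis using that by (auto elim!: BseqE)
qed

lemma padic_cauchy_mult:
  assumes p: "prime p" and X: "padic_cauchy p X" and Y: "padic_cauchy p Y"
  shows "padic_cauchy p (\<lambda>n. X n * Y n)"
  unfolding padic_cauchy_def
proof (intro allI impI)
  fix e :: real assume e: "e > 0"
  obtain a where a: "a > 0" "\<And>n. rat_padic_abs p (X n) \<le> a"
    using padic_cauchy_bounded[OF p X] by blast
  obtain b where b: "b > 0" "\<And>n. rat_padic_abs p (Y n) \<le> b"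
    using padic_cauchy_bounded[OF p Y] by blast
  have "e / b > 0" "e / a > 0" using e a b by simp_all
  then obtain M N where
    M: "\<And>m n. m \<ge> M \<Longrightarrow> n \<ge> M \<Longrightarrow> rat_padic_abs p (X m - X n) < e / b" and
    N: "\<And>m n. m \<ge> N \<Longrightarrow> n \<ge> N \<Longrightarrow> rat_padic_abs p (Y m - Y n) < e / a"
    using X Y unfolding padic_cauchy_def by metis
  have "rat_padic_abs p (X m * Y m - X n * Y n) < e" if "m \<ge> max M N" "n \<ge> max M N" for m n
  proof -
    have "X m * Y m - X n * Y n = X m * (Y m - Y n) + (X m - X n) * Y n"
      by (simp add: algebra_simps)
    then have "rat_padic_abs p (X m * Y m - X n * Y n) \<le>
        max (rat_padic_abs p (X m) * rat_padic_abs p (Y m - Y n))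
            (rat_padic_abs p (X m - X n) * rat_padic_abs p (Y n))"
      using rat_padic_abs_add[OF p] by (metis rat_padic_abs_mult[OF p])
    moreover have "rat_padic_abs p (X m) * rat_padic_abs p (Y m - Y n) < a * (e / a)"
      by (rule order_le_less_trans[OF mult_right_mono[OF a(2)]])
        (use a N[of m n] that in \<open>auto simp: field_simps\<close>)
    moreover have "rat_padic_abs p (X m - X n) * rat_padic_abs p (Y n) < (e / b) * b"
      by (rule order_le_less_trans[OF mult_left_mono[OF b(2)]])
        (use b M[of m n] that in \<open>auto simp: field_simps\<close>)
    ultimately show ?thesis using a b by auto
  qed
  then show "\<exists>K. \<forall>m\<ge>K. \<forall>n\<ge>K. rat_padic_abs p (X m * Y m - X n * Y n) < e"
    by blast
qed

lemma padic_not_null_bound: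
  assumes p: "prime p" and X: "padic_cauchy p X" and nz: "\<not> padic_null p X"
  obtains b M where "b > 0" "\<And>n. n \<ge> M \<Longrightarrow> rat_padic_abs p (X n) > b"
proof -
  obtain L where L: "(\<lambda>n. rat_padic_abs p (X n)) \<longlonglongrightarrow> L"
    using padic_cauchy_abs[OF p X] by (auto simp: convergent_def)
  have "L \<ge> 0" using L by (rule LIMSEQ_le_const) auto
  moreover have "L \<noteq> 0" using L nz by (auto simp: padic_null_def)
  ultimately have L2: "L / 2 > 0" "L / 2 < L" by simp_all
  obtain M where "\<And>n. n \<ge> M \<Longrightarrow> rat_padic_abs p (X n) > L / 2"
    using order_tendstoD(1)[OF L L2(2)] unfolding eventually_sequentially by blast
  with L2(1) show ?thesis by (rule that)
qed

lemma rat_padic_abs_inverse_diff: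
  assumes p: "prime p" and b: "b > 0" "rat_padic_abs p x > b" "rat_padic_abs p y > b"
  shows "rat_padic_abs p (inverse x - inverse y) \<le> rat_padic_abs p (x - y) / (b * b)"
proof -
  have nz: "x \<noteq> 0" "y \<noteq> 0" using b by auto
  then have "inverse x - inverse y = (y - x) * inverse (x * y)"
    by (simp add: field_simps)
  then have "rat_padic_abs p (inverse x - inverse y) =
      rat_padic_abs p (x - y) / (rat_padic_abs p x * rat_padic_abs p y)"
    using p by (simp add: rat_padic_abs_mult rat_padic_abs_inverse divide_inverse
        rat_padic_abs_minus_commute[of p x y])
  also have "\<dots> \<le> rat_padic_abs p (x - y) / (b * b)"
    using b by (intro divide_left_mono mult_mono mult_pos_pos) auto
  finally show ?thesis .
qed

lemma padic_cauchy_inverse: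
  assumes p: "prime p" and X: "padic_cauchy p X" and nz: "\<not> padic_null p X"
  shows "padic_cauchy p (\<lambda>n. inverse (X n))"
  unfolding padic_cauchy_def
proof (intro allI impI)
  fix e :: real assume e: "e > 0"
  obtain b M where b: "b > 0" "\<And>n. n \<ge> M \<Longrightarrow> rat_padic_abs p (X n) > b"
    using padic_not_null_bound[OF assms] by blast
  have "e * (b * b) > 0" using e b by simp
  then obtain N where
    N: "\<And>m n. m \<ge> N \<Longrightarrow> n \<ge> N \<Longrightarrow> rat_padic_abs p (X m - X n) < e * (b * b)"
    using X unfolding padic_cauchy_def by metis
  have "rat_padic_abs p (inverse (X m) - inverse (X n)) < e"
    if "m \<ge> max M N" "n \<ge> max M N" for m n
  proof -
    have "rat_padic_abs p (inverse (X m) - inverse (X n)) \<le> rat_padic_abs p (X m - X n) / (b * b)"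
      using that b by (intro rat_padic_abs_inverse_diff[OF p]) auto
    also have "\<dots> < e * (b * b) / (b * b)"
      using that b N[of m n] by (intro divide_strict_right_mono) auto
    finally show ?thesis using b by simp
  qed
  then show "\<exists>K. \<forall>m\<ge>K. \<forall>n\<ge>K. rat_padic_abs p (inverse (X m) - inverse (X n)) < e"
    by blast
qed

definition padic_rel :: "nat \<Rightarrow> (nat \<Rightarrow> rat) \<Rightarrow> (nat \<Rightarrow> rat) \<Rightarrow> bool" where
  "padic_rel p X Y \<longleftrightarrow> padic_cauchy p X \<and> padic_cauchy p Y \<and> padic_null p (\<lambda>n. X n - Y n)"

lemma padic_rel_refl: "padic_cauchy p X \<Longrightarrow> padic_rel p X X"
  by (simp add: padic_rel_def)

lemma padic_rel_part_equivp:
  assumes p: "prime p"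
  shows "part_equivp (padic_rel p)"
proof (rule part_equivpI)
  show "\<exists>X. padic_rel p X X"
    using padic_rel_refl[OF padic_cauchy_const] by blast
  show "symp (padic_rel p)"
  proof (rule sympI)
    fix X Y assume "padic_rel p X Y"
    then show "padic_rel p Y X"
      using padic_null_minus[of p "\<lambda>n. X n - Y n"] by (simp add: padic_rel_def)
  qed
  show "transp (padic_rel p)"
  proof (rule transpI)
    fix X Y Z assume "padic_rel p X Y" "padic_rel p Y Z"
    then show "padic_rel p X Z"
      using padic_null_add[OF p, of "\<lambda>n. X n - Y n" "\<lambda>n. Y n - Z n"] by (simp add: padic_rel_def)
  qed
qed

(* The command quotient_type does not support partial quotients with a phantom type parameter,
  so the quotient is set up by hand. *)

typedef (overloaded) ('p::prime_card) padic =
  "{C. \<exists>X. padic_rel CARD('p) X X \<and> C = Collect (padic_rel CARD('p) X)}"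
  morphisms padic_class Padic_class
  using padic_rel_refl[OF padic_cauchy_const] by blast

definition Padic :: "(nat \<Rightarrow> rat) \<Rightarrow> 'p::prime_card padic" where
  "Padic X = Padic_class (Collect (padic_rel CARD('p) X))"

definition padic_rep :: "'p::prime_card padic \<Rightarrow> nat \<Rightarrow> rat" where
  "padic_rep x = (SOME X. X \<in> padic_class x)"

definition cr_padic :: "(nat \<Rightarrow> rat) \<Rightarrow> 'p::prime_card padic \<Rightarrow> bool" where
  "cr_padic X x \<longleftrightarrow> padic_rel CARD('p) X X \<and> Padic X = x"

lemma Quotient_padic:
  "Quotient (padic_rel CARD('p)) Padic padic_rep (cr_padic :: _ \<Rightarrow> 'p::prime_card padic \<Rightarrow> bool)"
proof -
  interpret quot_type "padic_rel CARD('p)" "Padic_class :: _ \<Rightarrow> 'p padic" padic_class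
  proof
    show "part_equivp (padic_rel CARD('p))"
      by (rule padic_rel_part_equivp[OF prime_card])
    show "\<exists>X. padic_rel CARD('p) X X \<and> padic_class x = Collect (padic_rel CARD('p) X)"
      for x :: "'p padic"
      using padic_class[of x] by simp
    show "Padic_class (padic_class x) = x" for x :: "'p padic"
      by (rule padic_class_inverse)
    show "padic_class (Padic_class C :: 'p padic) = C"
      if "\<exists>X. padic_rel CARD('p) X X \<and> C = Collect (padic_rel CARD('p) X)" for C
      using that by (intro Padic_class_inverse CollectI)
    show "padic_class x = padic_class y \<longleftrightarrow> x = y" for x y :: "'p padic"
      by (rule padic_class_inject)
  qed
  have "abs = (Padic :: _ \<Rightarrow> 'p padic)" "rep = (padic_rep :: 'p padic \<Rightarrow> _)"
    by (auto simp: fun_eq_iff abs_def rep_def Padic_def padic_rep_def)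
  then have "Quotient3 (padic_rel CARD('p)) (Padic :: _ \<Rightarrow> 'p padic) padic_rep"
    using Quotient by simp
  then show ?thesis
    by (rule Quotient3_to_Quotient) (auto intro!: eq_reflection simp: fun_eq_iff cr_padic_def)
qed

setup_lifting Quotient_padic

instantiation padic :: (prime_card) field
begin

lift_definition zero_padic :: "'a padic" is "\<lambda>n. 0"
  by (simp add: padic_rel_refl)

lift_definition one_padic :: "'a padic" is "\<lambda>n. 1"
  by (simp add: padic_rel_refl)

lift_definition plus_padic :: "'a padic \<Rightarrow> 'a padic \<Rightarrow> 'a padic" is "\<lambda>X Y n. X n + Y n"
  subgoal for X X' Y Y'
    using padic_null_add[OF prime_card[where ?'a = 'a], of "\<lambda>n. X n - X' n" "\<lambda>n. Y n - Y' n"]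
    by (simp add: padic_rel_def padic_cauchy_add[OF prime_card] algebra_simps)
  done

lift_definition uminus_padic :: "'a padic \<Rightarrow> 'a padic" is "\<lambda>X n. - X n"
  subgoal for X X'
    using padic_null_minus[of _ "\<lambda>n. X n - X' n"]
    by (simp add: padic_rel_def padic_cauchy_minus)
  done

lift_definition times_padic :: "'a padic \<Rightarrow> 'a padic \<Rightarrow> 'a padic" is "\<lambda>X Y n. X n * Y n"
  subgoal premises prems for X X' Y Y'
  proof -
    let ?p = "CARD('a)"
    have X: "padic_cauchy ?p X" "padic_cauchy ?p X'" "padic_null ?p (\<lambda>n. X n - X' n)"
      and Y: "padic_cauchy ?p Y" "padic_cauchy ?p Y'" "padic_null ?p (\<lambda>n. Y n - Y' n)"
      using prems by (simp_all add: padic_rel_def)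
    obtain a where a: "a > 0" "\<And>n. rat_padic_abs ?p (X n) \<le> a"
      using padic_cauchy_bounded[OF prime_card X(1)] by blast
    obtain b where b: "b > 0" "\<And>n. rat_padic_abs ?p (Y' n) \<le> b"
      using padic_cauchy_bounded[OF prime_card Y(2)] by blast
    have "padic_null ?p (\<lambda>n. (Y n - Y' n) * X n)"
      by (rule padic_null_le[OF Y(3), of _ a])
        (auto simp: rat_padic_abs_mult[OF prime_card] intro!: mult_left_mono a)
    moreover have "padic_null ?p (\<lambda>n. (X n - X' n) * Y' n)"
      by (rule padic_null_le[OF X(3), of _ b])
        (auto simp: rat_padic_abs_mult[OF prime_card] intro!: mult_left_mono b)
    ultimately have "padic_null ?p (\<lambda>n. (Y n - Y' n) * X n + (X n - X' n) * Y' n)"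
      by (rule padic_null_add[OF prime_card])
    then show ?thesis
      using X Y by (simp add: padic_rel_def padic_cauchy_mult[OF prime_card] algebra_simps)
  qed
  done

lift_definition inverse_padic :: "'a padic \<Rightarrow> 'a padic"
  is "\<lambda>X. if padic_null CARD('a) X then (\<lambda>n. 0) else (\<lambda>n. inverse (X n))"
  subgoal premises prems for X Y
  proof -
    let ?p = "CARD('a)"
    have X: "padic_cauchy ?p X" and Y: "padic_cauchy ?p Y"
      and XY: "padic_null ?p (\<lambda>n. X n - Y n)"
      using prems by (simp_all add: padic_rel_def)
    have iff: "padic_null ?p X \<longleftrightarrow> padic_null ?p Y"
      using padic_null_add[OF prime_card XY, of Y]
        padic_null_add[OF prime_card padic_null_minus[OF XY], of X] by auto
    show ?thesis
    proof (cases "padic_null ?p X")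
      case False
      then have F: "\<not> padic_null ?p Y" using iff by simp
      obtain a M where a: "a > 0" "\<And>n. n \<ge> M \<Longrightarrow> rat_padic_abs ?p (X n) > a"
        using padic_not_null_bound[OF prime_card X False] by blast
      obtain b N where b: "b > 0" "\<And>n. n \<ge> N \<Longrightarrow> rat_padic_abs ?p (Y n) > b"
        using padic_not_null_bound[OF prime_card Y F] by blast
      define c where "c = min a b"
      have "c > 0" using a b by (simp add: c_def)
      have "rat_padic_abs ?p (inverse (X n) - inverse (Y n)) \<le>
          rat_padic_abs ?p (X n - Y n) * inverse (c * c)" if "n \<ge> max M N" for n
      proof -
        have "rat_padic_abs ?p (X n) > c" "rat_padic_abs ?p (Y n) > c"
          using a(2)[of n] b(2)[of n] that by (auto simp: c_def)
        from rat_padic_abs_inverse_diff[OF prime_card \<open>c > 0\<close> this]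
        show ?thesis by (simp only: divide_inverse)
      qed
      then have "padic_null ?p (\<lambda>n. inverse (X n) - inverse (Y n))"
        by (rule padic_null_eventually[OF eventually_sequentiallyI XY])
      then show ?thesis using False F X Y
        by (simp add: padic_rel_def padic_cauchy_inverse[OF prime_card])
    qed (use iff in \<open>simp add: padic_rel_refl\<close>)
  qed
  done

definition minus_padic :: "'a padic \<Rightarrow> 'a padic \<Rightarrow> 'a padic" where
  "minus_padic x y = x + - y"

definition divide_padic :: "'a padic \<Rightarrow> 'a padic \<Rightarrow> 'a padic" where
  "divide_padic x y = x * inverse y"

instance
proof
  fix a b c :: "'a padic"
  show "a + b = b + a"
    by transfer (simp add: ac_simps padic_rel_def padic_cauchy_add[OF prime_card])
  show "(a + b) + c = a + (b + c)"
    by transfer (simp add: ac_simps padic_rel_def padic_cauchy_add[OF prime_card])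
  show "0 + a = a"
    by transfer (simp add: padic_rel_def)
  show "- a + a = 0"
    by transfer (simp add: padic_rel_def)
  show "a - b = a + - b"
    by (rule minus_padic_def)
  show "(a * b) * c = a * (b * c)"
    by transfer (simp add: ac_simps padic_rel_def padic_cauchy_mult[OF prime_card])
  show "a * b = b * a"
    by transfer (simp add: ac_simps padic_rel_def padic_cauchy_mult[OF prime_card])
  show "1 * a = a"
    by transfer (simp add: padic_rel_def)
  show "(a + b) * c = a * c + b * c"
    by transfer (simp add: distrib_right padic_rel_def padic_cauchy_add[OF prime_card]
        padic_cauchy_mult[OF prime_card])
  show "(0::'a padic) \<noteq> 1"
    by transfer (simp add: padic_rel_def padic_null_def LIMSEQ_const_iff)
  show "a div b = a * inverse b"
    by (rule divide_padic_def)
  show "inverse (0::'a padic) = 0"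
    by transfer (simp add: padic_rel_def)
  show "a \<noteq> 0 \<Longrightarrow> inverse a * a = 1"
  proof transfer
    fix X :: "nat \<Rightarrow> rat"
    let ?p = "CARD('a)"
    assume "padic_rel ?p X X" "\<not> padic_rel ?p X (\<lambda>n. 0)"
    then have X: "padic_cauchy ?p X" "\<not> padic_null ?p X"
      by (simp_all add: padic_rel_def)
    obtain b M where b: "b > 0" "\<And>n. n \<ge> M \<Longrightarrow> rat_padic_abs ?p (X n) > b"
      using padic_not_null_bound[OF prime_card X] by blast
    have "inverse (X n) * X n - 1 = 0" if "n \<ge> M" for n
      using b(1) b(2)[OF that] by (cases "X n = 0") auto
    then have "padic_null ?p (\<lambda>n. inverse (X n) * X n - 1)"
      by (intro padic_null_eventually[OF eventually_sequentiallyI[of M] padic_null_0, of _ _ 0])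
        simp
    then show "padic_rel ?p (\<lambda>n. (if padic_null ?p X then \<lambda>n. 0 else (\<lambda>n. inverse (X n))) n * X n)
        (\<lambda>n. 1)"
      using X by (simp add: padic_rel_def padic_cauchy_inverse[OF prime_card]
          padic_cauchy_mult[OF prime_card])
  qed
qed

end

lift_definition padic_abs :: "'p::prime_card padic \<Rightarrow> real"
  is "\<lambda>X. lim (\<lambda>n. rat_padic_abs CARD('p) (X n))"
  subgoal premises prems for X Y
  proof -
    let ?p = "CARD('p)"
    have X: "padic_cauchy ?p X" and Y: "padic_cauchy ?p Y"
      and XY: "padic_null ?p (\<lambda>n. X n - Y n)"
      using prems by (simp_all add: padic_rel_def)
    obtain L where L: "(\<lambda>n. rat_padic_abs ?p (X n)) \<longlonglongrightarrow> L"
      using padic_cauchy_abs[OF prime_card X] by (auto simp: convergent_def)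
    have "(\<lambda>n. rat_padic_abs ?p (X n) - rat_padic_abs ?p (Y n)) \<longlonglongrightarrow> 0"
      using XY[unfolded padic_null_def]
      by (rule Lim_null_comparison[rotated]) (simp add: rat_padic_abs_triangle3[OF prime_card])
    from tendsto_diff[OF L this] have "(\<lambda>n. rat_padic_abs ?p (Y n)) \<longlonglongrightarrow> L"
      by simp
    with L show ?thesis by (simp add: limI)
  qed
  done


lemma padic_cases:
  fixes x :: "'p::prime_card padic"
  obtains X where "padic_cauchy CARD('p) X" "x = Padic X"
proof (rule that)
  show "x = Padic (padic_rep x)"
    using Quotient_abs_rep[OF Quotient_padic, of x] by simp
  show "padic_cauchy CARD('p) (padic_rep x)"
    using Quotient_rep_reflp[OF Quotient_padic, of x] by (simp add: padic_rel_def)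
qed

lemma Padic_eq_iff:
  assumes "padic_cauchy CARD('p) X" "padic_cauchy CARD('p) Y"
  shows "(Padic X :: 'p::prime_card padic) = Padic Y \<longleftrightarrow> padic_null CARD('p) (\<lambda>n. X n - Y n)"
  using Quotient_rel[OF Quotient_padic[where ?'p = 'p], of X Y] assms
  by (auto simp: padic_rel_def)

lemma Padic_add:
  assumes "padic_cauchy CARD('p) X" "padic_cauchy CARD('p) Y"
  shows "(Padic X :: 'p::prime_card padic) + Padic Y = Padic (\<lambda>n. X n + Y n)"
  by (rule plus_padic.abs_eq) (simp_all add: padic_rel_refl assms)

lemma Padic_mult:
  assumes "padic_cauchy CARD('p) X" "padic_cauchy CARD('p) Y"
  shows "(Padic X :: 'p::prime_card padic) * Padic Y = Padic (\<lambda>n. X n * Y n)"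
  by (rule times_padic.abs_eq) (simp_all add: padic_rel_refl assms)

lemma Padic_minus:
  assumes "padic_cauchy CARD('p) X"
  shows "- (Padic X :: 'p::prime_card padic) = Padic (\<lambda>n. - X n)"
  by (rule uminus_padic.abs_eq) (simp add: padic_rel_refl assms)

lemma Padic_diff:
  assumes "padic_cauchy CARD('p) X" "padic_cauchy CARD('p) Y"
  shows "(Padic X :: 'p::prime_card padic) - Padic Y = Padic (\<lambda>n. X n - Y n)"
  using assms by (simp add: minus_padic_def Padic_minus Padic_add padic_cauchy_minus)

lemma padic_abs_Padic:
  assumes "padic_cauchy CARD('p) X"
  shows "(\<lambda>n. rat_padic_abs CARD('p) (X n)) \<longlonglongrightarrow> padic_abs (Padic X :: 'p::prime_card padic)"
proof -
  have "padic_abs (Padic X :: 'p padic) = lim (\<lambda>n. rat_padic_abs CARD('p) (X n))"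
    by (rule padic_abs.abs_eq) (simp add: padic_rel_refl assms)
  then show ?thesis
    using padic_cauchy_abs[OF prime_card assms] by (simp add: convergent_LIMSEQ_iff)
qed

lemma padic_abs_nonneg [simp]: "padic_abs x \<ge> 0"
proof (cases x rule: padic_cases)
  case (1 X)
  show ?thesis unfolding 1(2) by (rule LIMSEQ_le_const[OF padic_abs_Padic[OF 1(1)]]) auto
qed

lemma padic_abs_eq_0 [simp]: "padic_abs x = 0 \<longleftrightarrow> x = 0"
  for x :: "'p::prime_card padic"
proof (cases x rule: padic_cases)
  case (1 X)
  have "x = 0 \<longleftrightarrow> padic_null CARD('p) X"
    using Padic_eq_iff[OF 1(1) padic_cauchy_const[of _ 0]] by (simp add: 1(2) zero_padic_def)
  also have "\<dots> \<longleftrightarrow> padic_abs x = 0"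
    using padic_abs_Padic[OF 1(1)] unfolding padic_null_def 1(2) by (metis LIMSEQ_unique)
  finally show ?thesis by simp
qed

lemma padic_abs_mult: "padic_abs (x * y) = padic_abs x * padic_abs y"
  for x y :: "'p::prime_card padic"
proof (cases x rule: padic_cases)
  case (1 X)
  show ?thesis
  proof (cases y rule: padic_cases)
    case (1 Y)
    note XY = \<open>padic_cauchy CARD('p) X\<close> \<open>padic_cauchy CARD('p) Y\<close>
    have "(\<lambda>n. rat_padic_abs CARD('p) (X n * Y n)) \<longlonglongrightarrow> padic_abs (x * y)"
      using padic_abs_Padic[OF padic_cauchy_mult[OF prime_card XY]] XY
      by (simp add: Padic_mult \<open>x = Padic X\<close> \<open>y = Padic Y\<close>)
    moreover have "(\<lambda>n. rat_padic_abs CARD('p) (X n * Y n)) \<longlonglongrightarrow> padic_abs x * padic_abs y"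
      using tendsto_mult[OF padic_abs_Padic[OF XY(1)] padic_abs_Padic[OF XY(2)]]
      by (simp add: rat_padic_abs_mult[OF prime_card] \<open>x = Padic X\<close> \<open>y = Padic Y\<close>)
    ultimately show ?thesis by (rule LIMSEQ_unique)
  qed
qed

lemma padic_abs_add: "padic_abs (x + y) \<le> max (padic_abs x) (padic_abs y)"
  for x y :: "'p::prime_card padic"
proof (cases x rule: padic_cases)
  case (1 X)
  show ?thesis
  proof (cases y rule: padic_cases)
    case (1 Y)
    note XY = \<open>padic_cauchy CARD('p) X\<close> \<open>padic_cauchy CARD('p) Y\<close>
    have "(\<lambda>n. rat_padic_abs CARD('p) (X n + Y n)) \<longlonglongrightarrow> padic_abs (x + y)"
      using padic_abs_Padic[OF padic_cauchy_add[OF prime_card XY]] XY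
      by (simp add: Padic_add \<open>x = Padic X\<close> \<open>y = Padic Y\<close>)
    moreover have "(\<lambda>n. max (rat_padic_abs CARD('p) (X n)) (rat_padic_abs CARD('p) (Y n)))
        \<longlonglongrightarrow> max (padic_abs x) (padic_abs y)"
      using tendsto_max[OF padic_abs_Padic[OF XY(1)] padic_abs_Padic[OF XY(2)]]
      by (simp add: \<open>x = Padic X\<close> \<open>y = Padic Y\<close>)
    ultimately show ?thesis
      by (rule LIMSEQ_le) (simp add: rat_padic_abs_add[OF prime_card])
  qed
qed

lemma padic_abs_minus [simp]: "padic_abs (- x) = padic_abs x"
  for x :: "'p::prime_card padic"
proof (cases x rule: padic_cases)
  case (1 X)
  have "(\<lambda>n. rat_padic_abs CARD('p) (X n)) \<longlonglongrightarrow> padic_abs (- x)"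
    using padic_abs_Padic[OF padic_cauchy_minus[OF 1(1)]] by (simp add: Padic_minus 1)
  with padic_abs_Padic[OF 1(1)] show ?thesis unfolding 1(2) by (metis LIMSEQ_unique)
qed

lemma padic_abs_minus_commute: "padic_abs (x - y) = padic_abs (y - x)"
  using padic_abs_minus[of "x - y"] by simp

lemma of_nat_padic: "(of_nat n :: 'p::prime_card padic) = Padic (\<lambda>_. of_nat n)"
  by (induction n) (simp_all add: zero_padic_def one_padic_def Padic_add)

instance padic :: (prime_card) field_char_0
proof
  show "inj (of_nat :: nat \<Rightarrow> 'a padic)"
  proof (rule injI)
    fix m n assume "(of_nat m :: 'a padic) = of_nat n"
    then have "padic_null CARD('a) (\<lambda>_. of_nat m - of_nat n)"
      by (simp add: of_nat_padic Padic_eq_iff)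
    then show "m = n"
      by (simp add: padic_null_def LIMSEQ_const_iff prime_card)
  qed
qed

lemma of_int_padic: "(of_int k :: 'p::prime_card padic) = Padic (\<lambda>_. of_int k)"
  by (cases k rule: int_diff_cases) (simp add: of_nat_padic Padic_diff)

lemma of_rat_padic: "(of_rat r :: 'p::prime_card padic) = Padic (\<lambda>_. r)"
proof (cases r)
  case (Fract a b)
  have "(of_rat r :: 'p padic) * of_int b = of_int a"
    using Fract by (simp add: of_rat_rat)
  moreover have "(Padic (\<lambda>_. r) :: 'p padic) * of_int b = of_int a"
    using Fract by (simp add: of_int_padic Padic_mult Fract_of_int_quotient)
  moreover have "(of_int b :: 'p padic) \<noteq> 0" using Fract by simp
  ultimately show ?thesis by (metis mult_right_cancel)
qed

lemma padic_abs_of_rat [simp]: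
  "padic_abs (of_rat r :: 'p::prime_card padic) = rat_padic_abs CARD('p) r"
  using padic_abs_Padic[OF padic_cauchy_const[of "CARD('p)" r]]
  by (simp add: of_rat_padic LIMSEQ_const_iff)

instantiation padic :: (prime_card) metric_space
begin

definition dist_padic :: "'a padic \<Rightarrow> 'a padic \<Rightarrow> real" where
  "dist_padic x y = padic_abs (x - y)"

definition uniformity_padic :: "('a padic \<times> 'a padic) filter" where
  "uniformity_padic = (INF e\<in>{0<..}. principal {(x, y). dist x y < e})"

definition open_padic :: "'a padic set \<Rightarrow> bool" where
  "open_padic U \<longleftrightarrow> (\<forall>x\<in>U. eventually (\<lambda>(x', y). x' = x \<longrightarrow> y \<in> U) uniformity)"

instance
proof
  show "uniformity = (INF e\<in>{0<..}. principal {(x, y::'a padic). dist x y < e})"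
    by (rule uniformity_padic_def)
  show "open U \<longleftrightarrow> (\<forall>x\<in>U. eventually (\<lambda>(x', y). x' = x \<longrightarrow> y \<in> U) uniformity)"
    for U :: "'a padic set"
    by (rule open_padic_def)
  show "dist x y = 0 \<longleftrightarrow> x = y" for x y :: "'a padic"
    by (simp add: dist_padic_def)
  show "dist x y \<le> dist x z + dist y z" for x y z :: "'a padic"
  proof -
    have "padic_abs (x - y) \<le> max (padic_abs (x - z)) (padic_abs (y - z))"
      using padic_abs_add[of "x - z" "z - y"] by (simp add: padic_abs_minus_commute[of z y])
    then show ?thesis
      using padic_abs_nonneg[of "x - z"] padic_abs_nonneg[of "y - z"]
      unfolding dist_padic_def by linarith
  qed
qed

end

lemma padic_dense:
  fixes x :: "'p::prime_card padic"
  assumes "e > 0"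
  obtains r where "dist x (of_rat r) < e"
proof (cases x rule: padic_cases)
  case (1 X)
  obtain M where M: "\<And>m n. m \<ge> M \<Longrightarrow> n \<ge> M \<Longrightarrow> rat_padic_abs CARD('p) (X m - X n) < e / 2"
    using 1(1) assms unfolding padic_cauchy_def by (metis half_gt_zero)
  have "x - of_rat (X M) = Padic (\<lambda>m. X m - X M)"
    by (simp add: 1 of_rat_padic Padic_diff)
  moreover have "padic_abs (Padic (\<lambda>m. X m - X M) :: 'p padic) \<le> e / 2"
    by (rule LIMSEQ_le_const2[OF padic_abs_Padic])
      (use M in \<open>auto intro!: padic_cauchy_diff[OF prime_card] 1(1) less_imp_le exI[of _ M]\<close>)
  ultimately have "dist x (of_rat (X M)) \<le> e / 2"
    by (simp only: dist_padic_def)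
  then have "dist x (of_rat (X M)) < e"
    using assms by linarith
  then show ?thesis by (rule that)
qed

instance padic :: (prime_card) complete_space
proof
  fix F :: "nat \<Rightarrow> 'a padic" assume F: "Cauchy F"
  have "\<exists>r. dist (F n) (of_rat r) < inverse (real (Suc n))" for n
  proof (rule padic_dense)
    show "inverse (real (Suc n)) > 0" by simp
  qed (rule exI)
  then obtain R where R: "\<And>n. dist (F n) (of_rat (R n)) < inverse (real (Suc n))"
    by metis
  have lim0: "(\<lambda>n. dist (F n) (of_rat (R n))) \<longlonglongrightarrow> 0"
    by (rule Lim_null_comparison[OF _ LIMSEQ_inverse_real_of_nat])
      (use R in \<open>auto intro!: always_eventually less_imp_le\<close>)
  have "padic_cauchy CARD('a) R"
    unfolding padic_cauchy_def
  proof (intro allI impI)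
    fix e :: real assume "e > 0"
    then have e3: "e / 3 > 0" by simp
    obtain M where M: "\<And>m n. m \<ge> M \<Longrightarrow> n \<ge> M \<Longrightarrow> dist (F m) (F n) < e / 3"
      using F e3 unfolding Cauchy_def by blast
    obtain N where N: "\<And>n. n \<ge> N \<Longrightarrow> dist (F n) (of_rat (R n)) < e / 3"
      using order_tendstoD(2)[OF lim0 e3] unfolding eventually_sequentially by blast
    have "rat_padic_abs CARD('a) (R m - R n) < e" if "m \<ge> max M N" "n \<ge> max M N" for m n
    proof -
      have "rat_padic_abs CARD('a) (R m - R n) = dist (of_rat (R m) :: 'a padic) (of_rat (R n))"
        by (simp add: dist_padic_def flip: of_rat_diff)
      also have "\<dots> \<le> dist (F m) (of_rat (R m)) + dist (F m) (F n) + dist (F n) (of_rat (R n))"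
        by metric
      also have "\<dots> < e" using M[of m n] N[of m] N[of n] that by simp
      finally show ?thesis .
    qed
    then show "\<exists>K. \<forall>m\<ge>K. \<forall>n\<ge>K. rat_padic_abs CARD('a) (R m - R n) < e" by blast
  qed
  note R_cauchy = this
  define L :: "'a padic" where "L = Padic R"
  have "F \<longlonglongrightarrow> L"
  proof (rule metric_LIMSEQ_I)
    fix e :: real assume "e > 0"
    then have e2: "e / 2 > 0" by simp
    obtain N where N: "\<And>n. n \<ge> N \<Longrightarrow> dist (F n) (of_rat (R n)) < e / 2"
      using order_tendstoD(2)[OF lim0 e2] unfolding eventually_sequentially by blast
    obtain M where M: "\<And>m n. m \<ge> M \<Longrightarrow> n \<ge> M \<Longrightarrow> rat_padic_abs CARD('a) (R m - R n) < e / 2"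
      using R_cauchy e2 unfolding padic_cauchy_def by metis
    have "dist (F n) L < e" if n: "n \<ge> max M N" for n
    proof -
      have "L - of_rat (R n) = Padic (\<lambda>m. R m - R n)"
        by (simp add: L_def R_cauchy of_rat_padic Padic_diff)
      moreover have "padic_abs (Padic (\<lambda>m. R m - R n) :: 'a padic) \<le> e / 2"
        by (rule LIMSEQ_le_const2[OF padic_abs_Padic])
          (use M n in \<open>auto intro!: padic_cauchy_diff[OF prime_card] R_cauchy less_imp_le exI[of _ M]\<close>)
      ultimately have "dist L (of_rat (R n)) \<le> e / 2" by (simp add: dist_padic_def)
      moreover have "dist (F n) L \<le> dist (F n) (of_rat (R n)) + dist L (of_rat (R n))"
        by (rule dist_triangle2)
      ultimately show ?thesis using N[of n] n by simp
    qed
    then show "\<exists>no. \<forall>n\<ge>no. dist (F n) L < e" by blast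
  qed
  then show "convergent F" by (rule convergentI)
qed

definition padic_sphere :: "real \<Rightarrow> 'p::prime_card padic \<Rightarrow> 'p padic set" where
  "padic_sphere r a = {x. padic_abs (x - a) = r}"

definition padic_annulus :: "real \<Rightarrow> real \<Rightarrow> 'p::prime_card padic \<Rightarrow> 'p padic set" where
  "padic_annulus r s a = {x. r < padic_abs (x - a) \<and> padic_abs (x - a) < s}"


section \<open>The dynamical system\<close>

definition potts_map :: "'a::field \<Rightarrow> 'a \<Rightarrow> 'a \<Rightarrow> 'a" where
  "potts_map \<theta> q x = ((\<theta> * x + q) / (x + \<theta> + q - 1))\<^sup>2"

text \<open>
  Since \<open>z / 0 = 0\<close> in HOL, \<^const>\<open>potts_map\<close> takes the value 0 at its pole. The n-th iterate
  is defined at a point exactly when the first n points of the orbit avoid the pole, and this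
  is required explicitly below.
\<close>

definition iterate_defined :: "'a::field \<Rightarrow> 'a \<Rightarrow> nat \<Rightarrow> 'a \<Rightarrow> bool" where
  "iterate_defined \<theta> q n x \<longleftrightarrow> (\<forall>k<n. (potts_map \<theta> q ^^ k) x \<noteq> 1 - \<theta> - q)"

definition basin :: "'p::prime_card padic \<Rightarrow> 'p padic \<Rightarrow> 'p padic \<Rightarrow> 'p padic set" where
  "basin \<theta> q a = {y. (\<forall>n. iterate_defined \<theta> q n y) \<and> (\<lambda>n. (potts_map \<theta> q ^^ n) y) \<longlonglongrightarrow> a}"

definition reaching_set ::
    "'p::prime_card padic \<Rightarrow> 'p padic \<Rightarrow> 'p padic set \<Rightarrow> 'p padic set" where
  "reaching_set \<theta> q B =
    {x \<in> padic_sphere 1 0. \<exists>n. iterate_defined \<theta> q n x \<and> (potts_map \<theta> q ^^ n) x \<in> B}"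

end

theory Submission
  imports Defs
begin

text \<open>
  Write \<open>f = g\<^sup>2\<close> with \<open>g x = (\<theta> x + q) / (x + \<theta> + q - 1)\<close>. On the open unit ball \<open>f\<close> is a
  contraction with factor \<open>\<bar>q\<bar>\<^sup>2\<close>, so this ball lies in the basin of its fixed point \<open>x1\<close>.
  Points of absolute value greater than 1, and points with \<open>\<bar>x - 1\<bar> > \<bar>q\<bar>\<close>, are mapped
  into the ball in one step. The fixed points 1 and \<open>x2\<close> are repelling: on the ball of radius
  \<open>\<bar>q\<bar>\<close> around either of them \<open>f\<close> expands distances to the centre by the factor \<open>1 / \<bar>q\<bar>\<close>,
  so the annulus with radii \<open>\<bar>q\<bar>\<^sup>2\<close> and \<open>\<bar>q\<bar>\<close> is mapped into \<open>{x. \<bar>x - 1\<bar> > \<bar>q\<bar>}\<close>.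
\<close>

section \<open>The ultrametric absolute value\<close>

lemma padic_abs_0 [simp]: "padic_abs (0 :: 'p::prime_card padic) = 0"
  by simp

lemma padic_abs_1 [simp]: "padic_abs (1 :: 'p::prime_card padic) = 1"
  using padic_abs_of_rat[of 1, where 'p = 'p] by (simp del: padic_abs_of_rat)

lemma padic_abs_pos_iff [simp]: "padic_abs x > 0 \<longleftrightarrow> x \<noteq> 0"
  for x :: "'p::prime_card padic"
  using padic_abs_nonneg[of x] padic_abs_eq_0[of x] by linarith

lemma padic_abs_power: "padic_abs (x ^ n) = padic_abs x ^ n"
  for x :: "'p::prime_card padic"
  by (induction n) (simp_all add: padic_abs_mult)

lemma padic_abs_divide: "padic_abs (x / y) = padic_abs x / padic_abs y"
  for x y :: "'p::prime_card padic"
proof (cases "y = 0")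
  case False
  then have "padic_abs (x / y) * padic_abs y = padic_abs x"
    by (simp flip: padic_abs_mult)
  with False show ?thesis
    by (simp add: eq_divide_eq)
qed simp

lemma padic_abs_add_less: "padic_abs x < r \<Longrightarrow> padic_abs y < r \<Longrightarrow> padic_abs (x + y) < r"
  for x y :: "'p::prime_card padic"
  using padic_abs_add[of x y] by simp

text \<open>The larger term dominates: otherwise \<open>y\<close>, as the sum of
  \<open>x + y\<close> and \<open>- x\<close>, would be smaller than itself.\<close>

lemma padic_abs_add_eq_right:
  fixes x y :: "'p::prime_card padic"
  assumes "padic_abs x < padic_abs y"
  shows "padic_abs (x + y) = padic_abs y"
  using padic_abs_add[of x y] padic_abs_add[of "x + y" "- x"] assms by auto

lemma padic_abs_add_eq_left:
  "padic_abs y < padic_abs x \<Longrightarrow> padic_abs (x + y) = padic_abs x"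
  for x y :: "'p::prime_card padic"
  using padic_abs_add_eq_right[of y x] by (simp add: add.commute)

text \<open>Oddness of the prime enters here; \<open>expansion\<close> needs it so that the sum of
  two nearby units stays a unit.\<close>

lemma padic_abs_2:
  assumes "CARD('p::prime_card) \<ge> 3"
  shows "padic_abs (2 :: 'p padic) = 1"
proof -
  have "\<not> CARD('p) dvd 2"
    using assms by (auto dest: dvd_imp_le)
  then have "multiplicity (int CARD('p)) 2 = 0"
    by (metis int_dvd_int_iff not_dvd_imp_multiplicity_0 of_nat_numeral)
  moreover have "quotient_of 2 = (2, 1)"
    by (rule quotient_of_number)
  ultimately have "rat_padic_abs CARD('p) 2 = 1"
    by (simp add: rat_padic_abs_def)
  then show ?thesis
    using padic_abs_of_rat[of 2, where 'p = 'p] by (simp del: padic_abs_of_rat)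
qed

section \<open>Basins of attraction\<close>

text \<open>The first hypothesis keeps the first \<open>n\<close> points off the pole, the second
  does so for the rest, and a shift of the index does not change the limit.\<close>

lemma basin_funpow:
  assumes "iterate_defined \<theta> q n x" and "(potts_map \<theta> q ^^ n) x \<in> basin \<theta> q a"
  shows "x \<in> basin \<theta> q a"
proof -
  have *: "(potts_map \<theta> q ^^ m) ((potts_map \<theta> q ^^ n) x) = (potts_map \<theta> q ^^ (m + n)) x" for m
    by (simp add: funpow_add)
  have "(potts_map \<theta> q ^^ k) x \<noteq> 1 - \<theta> - q" for k
  proof (cases "k < n")
    case False
    then have "(potts_map \<theta> q ^^ (k - n)) ((potts_map \<theta> q ^^ n) x) \<noteq> 1 - \<theta> - q"
      using assms(2) unfolding basin_def iterate_defined_def by blast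
    with False show ?thesis by (simp add: *)
  qed (use assms(1) in \<open>simp add: iterate_defined_def\<close>)
  moreover have "(\<lambda>m. (potts_map \<theta> q ^^ m) x) \<longlonglongrightarrow> a"
    using assms(2) by (subst LIMSEQ_offset[of _ n]) (simp_all add: basin_def *)
  ultimately show ?thesis
    by (simp add: basin_def iterate_defined_def)
qed

lemma basin_step:
  assumes "x \<noteq> 1 - \<theta> - q" and "potts_map \<theta> q x \<in> basin \<theta> q a"
  shows "x \<in> basin \<theta> q a"
  using basin_funpow[of \<theta> q 1 x a] assms by (simp add: iterate_defined_def)

text \<open>Reduces the claims on J(B) to inclusions for the annuli B themselves.\<close>

lemma reaching_set_subset_basin:
  "B \<subseteq> basin \<theta> q a \<Longrightarrow> reaching_set \<theta> q B \<subseteq> basin \<theta> q a"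
  unfolding reaching_set_def by (auto intro: basin_funpow)

lemma potts_map_fixed_point:
  assumes "x\<^sup>2 + (2 * \<theta> - \<theta>\<^sup>2 + 2 * q - 1) * x + q\<^sup>2 = 0" and "x \<noteq> 1 - \<theta> - q"
  shows "potts_map \<theta> q x = x"
proof -
  \<comment> \<open>Cleared of its denominator, the fixed point equation splits off the root 1 and
    leaves the quadratic.\<close>
  have "x * (x + \<theta> + q - 1)\<^sup>2 - (\<theta> * x + q)\<^sup>2
      = (x - 1) * (x\<^sup>2 + (2 * \<theta> - \<theta>\<^sup>2 + 2 * q - 1) * x + q\<^sup>2)"
    by (simp add: power2_eq_square algebra_simps)
  moreover have "x + \<theta> + q - 1 \<noteq> 0"
    using assms(2) by (auto simp: algebra_simps add_eq_0_iff)
  ultimately show ?thesis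
    using assms(1) by (simp add: potts_map_def power_divide divide_eq_eq)
qed

text \<open>Difference of two squares; \<open>\<theta> * c - q\<close> is the determinant of the
  Moebius map \<open>g\<close>. Both contraction and expansion are read off from this
  formula.\<close>

lemma potts_map_diff:
  fixes \<theta> q x y :: "'a::field"
  defines "c \<equiv> \<theta> + q - 1"
  assumes "x + c \<noteq> 0" and "y + c \<noteq> 0"
  shows "potts_map \<theta> q x - potts_map \<theta> q y =
    (x - y) * (\<theta> * c - q) / ((x + c) * (y + c)) *
    ((\<theta> * x + q) / (x + c) + (\<theta> * y + q) / (y + c))"
proof -
  have "(\<theta> * x + q) / (x + c) - (\<theta> * y + q) / (y + c) =
      ((\<theta> * x + q) * (y + c) - (\<theta> * y + q) * (x + c)) / ((x + c) * (y + c))"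
    using assms(2,3) by (rule diff_frac_eq)
  also have "(\<theta> * x + q) * (y + c) - (\<theta> * y + q) * (x + c) = (x - y) * (\<theta> * c - q)"
    by (simp add: algebra_simps)
  finally have diff: "(\<theta> * x + q) / (x + c) - (\<theta> * y + q) / (y + c) =
      (x - y) * (\<theta> * c - q) / ((x + c) * (y + c))" .
  have "potts_map \<theta> q z = ((\<theta> * z + q) / (z + c))\<^sup>2" for z
    by (simp add: potts_map_def c_def add.assoc add_diff_eq)
  then show ?thesis
    unfolding diff[symmetric] by (simp only: power2_eq_square square_diff_square_factored mult.commute)
qed

section \<open>The dynamics for small parameters\<close>

locale small_potts =
  fixes \<theta> q :: "'p::prime_card padic"
  assumes q_nonzero: "q \<noteq> 0" and q_small: "padic_abs q < 1"
    and theta_small: "padic_abs \<theta> \<le> (padic_abs q)\<^sup>2"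
begin

abbreviation Q where "Q \<equiv> padic_abs q"
abbreviation f where "f \<equiv> potts_map \<theta> q"

section \<open>Sizes of numerator, denominator and determinant\<close>

lemma Q_pos: "Q > 0"
  using q_nonzero by simp

lemma Q2_less: "Q\<^sup>2 < Q"
  using Q_pos q_small by (simp add: power2_eq_square)

lemma theta_less: "padic_abs \<theta> < Q"
  using theta_small Q2_less by linarith

lemma abs_theta_q: "padic_abs (\<theta> + q) = Q"
  using theta_less by (rule padic_abs_add_eq_right)

text \<open>The denominator is \<open>(x - 1) + (\<theta> + q)\<close>, and the second term has
  absolute value \<open>Q\<close>: the pole lies at distance \<open>Q\<close> from 1.\<close>

lemma abs_denominator_far:
  assumes "padic_abs (x - 1) > Q"
  shows "padic_abs (x + (\<theta> + q - 1)) = padic_abs (x - 1)"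
  using padic_abs_add_eq_left[of "\<theta> + q" "x - 1"] assms abs_theta_q by (simp add: algebra_simps)

lemma abs_numerator:
  assumes "padic_abs x \<le> 1"
  shows "padic_abs (\<theta> * x + q) = Q"
proof (rule padic_abs_add_eq_right)
  have "padic_abs (\<theta> * x) \<le> padic_abs \<theta> * 1"
    unfolding padic_abs_mult by (intro mult_left_mono assms padic_abs_nonneg)
  with theta_less show "padic_abs (\<theta> * x) < Q" by simp
qed

text \<open>The determinant of \<open>g\<close>: since \<open>\<theta> + q - 1\<close> is a unit,
  its product with \<open>\<theta>\<close> is smaller than \<open>q\<close>.\<close>

lemma abs_resolvent: "padic_abs (\<theta> * (\<theta> + q - 1) - q) = Q"
proof -
  have "padic_abs (\<theta> + q - 1) = 1"
    using padic_abs_add_eq_right[of "\<theta> + q" "-1"] abs_theta_q q_small by simp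
  then show ?thesis
    using padic_abs_add_eq_right[of "\<theta> * (\<theta> + q - 1)" "- q"] theta_less
    by (simp add: padic_abs_mult)
qed

lemma not_pole: "padic_abs (x + (\<theta> + q - 1)) > 0 \<Longrightarrow> x \<noteq> 1 - \<theta> - q"
  by auto

lemma abs_minus_1_unit_ball: "padic_abs x < 1 \<Longrightarrow> padic_abs (x - 1) = 1"
  using padic_abs_add_eq_right[of x "-1"] by simp

lemma abs_denominator_unit_ball:
  assumes "padic_abs x < 1"
  shows "padic_abs (x + (\<theta> + q - 1)) = 1"
  using abs_denominator_far[of x] abs_minus_1_unit_ball[OF assms] q_small by simp

lemma abs_potts_map:
  "padic_abs (f x) = (padic_abs (\<theta> * x + q) / padic_abs (x + (\<theta> + q - 1)))\<^sup>2"
  by (simp add: potts_map_def padic_abs_power padic_abs_divide add.assoc add_diff_eq)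

section \<open>Contraction on the open unit ball\<close>

lemma abs_potts_map_unit_ball:
  assumes "padic_abs x < 1"
  shows "padic_abs (f x) < 1"
  using abs_numerator[of x] abs_denominator_unit_ball[OF assms] assms q_small Q_pos
  by (simp add: abs_potts_map power_less_one_iff)

text \<open>In \<open>potts_map_diff\<close> both denominators are units; the determinant gives one
  factor \<open>Q\<close>, the sum of the two values of \<open>g\<close> at most another.\<close>

lemma contraction_unit_ball:
  assumes x: "padic_abs x < 1" and y: "padic_abs y < 1"
  shows "padic_abs (f x - f y) \<le> Q\<^sup>2 * padic_abs (x - y)"
proof -
  let ?c = "\<theta> + q - 1"
  let ?g = "\<lambda>x. (\<theta> * x + q) / (x + ?c)"
  note den = abs_denominator_unit_ball[OF x] abs_denominator_unit_ball[OF y]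
  have nz: "x + ?c \<noteq> 0" "y + ?c \<noteq> 0"
    using den by (metis padic_abs_eq_0 zero_neq_one)+
  have "padic_abs (?g x + ?g y) \<le> Q"
    using padic_abs_add[of "?g x" "?g y"] abs_numerator[of x] abs_numerator[of y] x y den
    by (simp add: padic_abs_divide)
  then show ?thesis
    using mult_left_mono[of "padic_abs (?g x + ?g y)" Q "Q * padic_abs (x - y)"]
    unfolding potts_map_diff[OF nz] padic_abs_mult[of _ "?g x + ?g y"]
    by (simp add: padic_abs_mult[of "x - y"] padic_abs_divide abs_resolvent den padic_abs_mult[of "x + ?c"]
        power2_eq_square mult_ac)
qed

text \<open>The ball is invariant and free of the pole, and by contraction the distance to the fixed
  point decays geometrically.\<close>

lemma unit_ball_subset_basin:
  assumes a: "padic_abs a < 1" "f a = a"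
  shows "{x. padic_abs x < 1} \<subseteq> basin \<theta> q a"
proof
  fix x :: "'p padic" assume "x \<in> {x. padic_abs x < 1}"
  then have ball: "padic_abs ((f ^^ n) x) < 1" for n
    by (induction n) (simp_all add: abs_potts_map_unit_ball)
  have defined: "(f ^^ n) x \<noteq> 1 - \<theta> - q" for n
    using abs_denominator_unit_ball[OF ball[of n]] by (intro not_pole) simp
  have bound: "padic_abs ((f ^^ n) x - a) \<le> (Q\<^sup>2) ^ n * padic_abs (x - a)" for n
  proof (induction n)
    case (Suc n)
    have "padic_abs ((f ^^ Suc n) x - a) \<le> Q\<^sup>2 * padic_abs ((f ^^ n) x - a)"
      using contraction_unit_ball[OF ball[of n] a(1)] a(2) by simp
    also have "\<dots> \<le> Q\<^sup>2 * ((Q\<^sup>2) ^ n * padic_abs (x - a))"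
      by (intro mult_left_mono Suc) simp
    finally show ?case by (simp add: mult.assoc)
  qed simp
  have "(\<lambda>n. (Q\<^sup>2) ^ n * padic_abs (x - a)) \<longlonglongrightarrow> 0"
  proof (rule tendsto_mult_left_zero, rule LIMSEQ_realpow_zero)
    show "Q\<^sup>2 < 1" using Q2_less q_small by linarith
  qed simp
  then have "(\<lambda>n. dist ((f ^^ n) x) a) \<longlonglongrightarrow> 0"
    by (rule Lim_null_comparison[rotated]) (simp add: dist_padic_def bound)
  then have "(\<lambda>n. (f ^^ n) x) \<longlonglongrightarrow> a"
    by (subst tendsto_dist_iff)
  then show "x \<in> basin \<theta> q a"
    using defined by (simp add: basin_def iterate_defined_def)
qed

section \<open>Regions mapped into the ball in one step\<close>

lemma abs_potts_map_outside:
  assumes "padic_abs x > 1"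
  shows "padic_abs (f x) < 1" and "padic_abs (x - 1) > Q"
proof -
  have x1: "padic_abs (x - 1) = padic_abs x"
    using padic_abs_add_eq_left[of "-1" x] assms by simp
  then show "padic_abs (x - 1) > Q"
    using assms q_small by linarith
  then have den: "padic_abs (x + (\<theta> + q - 1)) = padic_abs x"
    using x1 abs_denominator_far by simp
  \<comment> \<open>Both terms of the numerator are smaller than \<open>x\<close>, which has the
    size of the denominator.\<close>
  have "padic_abs (\<theta> * x) < 1 * padic_abs x"
    unfolding padic_abs_mult by (rule mult_strict_right_mono) (use theta_less q_small assms in auto)
  then have "padic_abs (\<theta> * x + q) < padic_abs x"
    by (intro padic_abs_add_less) (use assms q_small in auto)
  then have "padic_abs (\<theta> * x + q) / padic_abs x < 1"
    using assms by (subst divide_less_eq_1_pos) linarith+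
  then show "padic_abs (f x) < 1"
    by (simp add: abs_potts_map den power_less_one_iff)
qed

lemma abs_potts_map_far:
  assumes "padic_abs x = 1" "padic_abs (x - 1) > Q"
  shows "padic_abs (f x) < 1"
proof -
  \<comment> \<open>This quotient is the absolute value of \<open>g x\<close>.\<close>
  have "Q / padic_abs (x - 1) < 1"
    using assms(2) Q_pos by (subst divide_less_eq_1_pos) linarith+
  then show ?thesis
    using abs_numerator[of x] abs_denominator_far[OF assms(2)] assms(1)
    by (simp add: abs_potts_map power_less_one_iff)
qed

lemma far_subset_basin:
  assumes "padic_abs a < 1" "f a = a"
  shows "{x. padic_abs (x - 1) > Q} \<subseteq> basin \<theta> q a"
proof
  fix x :: "'p padic" assume "x \<in> {x. padic_abs (x - 1) > Q}"
  then have x: "padic_abs (x - 1) > Q" by simp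
  \<comment> \<open>The cases are \<open>padic_abs x\<close> below, equal to and above 1.\<close>
  have "padic_abs (f x) < 1"
    using abs_potts_map_unit_ball[of x] abs_potts_map_far[OF _ x] abs_potts_map_outside(1)[of x]
    by argo
  moreover have "x \<noteq> 1 - \<theta> - q"
    using abs_denominator_far[OF x] x Q_pos by (intro not_pole) linarith
  ultimately show "x \<in> basin \<theta> q a"
    using unit_ball_subset_basin[OF assms] by - (rule basin_step, auto)
qed

section \<open>Expansion near the repelling fixed points\<close>

lemma expansion:
  assumes x: "padic_abs (x - c) < Q" and fixed: "f c = c" "padic_abs c = 1"
    and den: "padic_abs (c + (\<theta> + q - 1)) = Q" and two: "padic_abs (2 :: 'p padic) = 1"
  shows "padic_abs (f x - c) = padic_abs (x - c) / Q" and "x \<noteq> 1 - \<theta> - q"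
proof -
  let ?c = "\<theta> + q - 1"
  let ?g = "\<lambda>x. (\<theta> * x + q) / (x + ?c)"
  \<comment> \<open>The pole is at distance \<open>Q\<close> from \<open>c\<close>, and
    \<open>x\<close> is nearer to \<open>c\<close> than that.\<close>
  have denx: "padic_abs (x + ?c) = Q"
    using padic_abs_add_eq_right[of "x - c" "c + ?c"] x den by (simp add: algebra_simps)
  then show "x \<noteq> 1 - \<theta> - q"
    using Q_pos by (intro not_pole) simp
  have nz: "x + ?c \<noteq> 0" "c + ?c \<noteq> 0"
    using denx den q_nonzero by (metis padic_abs_eq_0)+
  have "?g x - ?g c = (x - c) * (\<theta> * ?c - q) / ((x + ?c) * (c + ?c))"
    unfolding diff_frac_eq[OF nz] by (simp add: algebra_simps)
  \<comment> \<open>The difference has absolute value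
    \<open>padic_abs (x - c) * Q / Q\<^sup>2\<close>.\<close>
  then have "padic_abs (?g x - ?g c) < 1"
    using x Q_pos by (simp add: padic_abs_mult padic_abs_divide abs_resolvent denx den)
  moreover have "padic_abs (2 * ?g c) = 1"
    using abs_numerator[of c] Q_pos fixed(2)
    unfolding padic_abs_mult[of 2] padic_abs_divide two den by simp
  \<comment> \<open>The sum is thus a unit, and \<open>potts_map_diff\<close> leaves only the factor
    \<open>Q / Q\<^sup>2\<close>.\<close>
  moreover have "?g x + ?g c = (?g x - ?g c) + 2 * ?g c"
    unfolding mult_2 by (simp only: diff_add_eq add_diff_cancel_right' add.assoc[symmetric] diff_add_cancel)
  ultimately have "padic_abs (?g x + ?g c) = 1"
    by (metis padic_abs_add_eq_right)
  then show "padic_abs (f x - c) = padic_abs (x - c) / Q"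
    using potts_map_diff[OF nz] Q_pos fixed(1)
    by (simp add: padic_abs_mult padic_abs_divide abs_resolvent denx den)
qed

text \<open>One step expands a distance above \<open>Q\<^sup>2\<close> to one above
  \<open>Q\<close>; as \<open>c\<close> is within \<open>Q\<close> of 1, the image is also farther
  than \<open>Q\<close> from 1.\<close>

lemma annulus_subset_basin:
  assumes a: "padic_abs a < 1" "f a = a"
    and c: "f c = c" "padic_abs c = 1" "padic_abs (c + (\<theta> + q - 1)) = Q" "padic_abs (c - 1) \<le> Q"
    and two: "padic_abs (2 :: 'p padic) = 1"
  shows "padic_annulus (Q\<^sup>2) Q c \<subseteq> basin \<theta> q a"
proof
  fix x assume "x \<in> padic_annulus (Q\<^sup>2) Q c"
  then have x: "Q\<^sup>2 < padic_abs (x - c)" "padic_abs (x - c) < Q"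
    by (simp_all add: padic_annulus_def)
  have "Q < padic_abs (f x - c)"
    using expansion(1)[OF x(2) c(1-3) two] x(1) Q_pos by (simp add: less_divide_eq power2_eq_square)
  then have "Q < padic_abs (f x - 1)"
    using padic_abs_add_eq_left[of "c - 1" "f x - c"] c(4) by simp
  then show "x \<in> basin \<theta> q a"
    using expansion(2)[OF x(2) c(1-3) two] far_subset_basin[OF a] by - (rule basin_step, auto)
qed

end

section \<open>Fixed points of the given map and the four regions\<close>

theorem theorem5p3:
  fixes p N :: nat and q :: int and \<theta> x1 x2 :: "'p::prime_card padic"
    and Q :: real
  assumes "p = CARD('p)" and "p \<ge> 3" and "q \<ge> 1" and "N \<ge> 1"
    and "\<theta> = of_nat p ^ N"
    and "Q = padic_abs (of_int q :: 'p padic)"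
    and "Q < 1" and "padic_abs \<theta> \<le> Q\<^sup>2"
    and "x1\<^sup>2 + (2 * \<theta> - \<theta>\<^sup>2 + 2 * of_int q - 1) * x1 + (of_int q)\<^sup>2 = 0"
    and "x2\<^sup>2 + (2 * \<theta> - \<theta>\<^sup>2 + 2 * of_int q - 1) * x2 + (of_int q)\<^sup>2 = 0"
    and "padic_abs x1 = Q\<^sup>2" and "padic_abs x2 = 1"
  shows "{x. padic_abs x \<noteq> 1}
       \<union> {x \<in> padic_sphere 1 0. padic_abs (x - 1) > Q}
       \<union> reaching_set \<theta> (of_int q) (padic_annulus (Q\<^sup>2) Q 1)
       \<union> reaching_set \<theta> (of_int q) (padic_annulus (Q\<^sup>2) Q x2)
       \<subseteq> basin \<theta> (of_int q) x1"
proof -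
  let ?q = "of_int q :: 'p padic"
  interpret small_potts \<theta> ?q
    using assms by unfold_locales auto
  have Q: "padic_abs ?q = Q"
    using assms by simp
  have two: "padic_abs (2 :: 'p padic) = 1"
    using assms by (intro padic_abs_2) simp
  have x1: "padic_abs x1 < 1"
    using Q2_less assms by simp
  have f_x1: "potts_map \<theta> ?q x1 = x1"
    using abs_denominator_unit_ball[OF x1] assms by (intro potts_map_fixed_point not_pole) simp_all
  \<comment> \<open>Vieta's formula for the sum of the roots, which are distinct because their
    absolute values differ.\<close>
  have "(x1 - x2) * (x1 + x2 + b) = (x1\<^sup>2 + b * x1 + c) - (x2\<^sup>2 + b * x2 + c)"
    for b c :: "'p padic"
    by (simp add: power2_eq_square algebra_simps)
  from this[of "2 * \<theta> - \<theta>\<^sup>2 + 2 * ?q - 1" "?q\<^sup>2"]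
  have "(x1 - x2) * (x1 + x2 + (2 * \<theta> - \<theta>\<^sup>2 + 2 * ?q - 1)) = 0"
    unfolding assms(9,10) by simp
  moreover have "x1 \<noteq> x2"
    using x1 assms by auto
  ultimately have "x1 + x2 + (2 * \<theta> - \<theta>\<^sup>2 + 2 * ?q - 1) = 0"
    by simp
  \<comment> \<open>This form shows the size of the denominator at \<open>x2\<close>:
    \<open>\<theta>\<^sup>2 - x1\<close> is smaller than \<open>\<theta> + ?q\<close>.\<close>
  then have vieta: "x2 + (\<theta> + ?q - 1) = (\<theta>\<^sup>2 - x1) + - (\<theta> + ?q)"
    by (simp add: algebra_simps eq_neg_iff_add_eq_0)
  have "padic_abs (\<theta>\<^sup>2) < Q"
    using theta_less Q mult_left_le[of "padic_abs \<theta>" "padic_abs \<theta>"] assms(7)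
    by (simp add: padic_abs_mult power2_eq_square)
  then have "padic_abs (\<theta>\<^sup>2 - x1) < Q"
    using padic_abs_add_less[of "\<theta>\<^sup>2" Q "- x1"] Q2_less Q assms(11) by simp
  then have den_x2: "padic_abs (x2 + (\<theta> + ?q - 1)) = padic_abs ?q"
    unfolding vieta by (subst padic_abs_add_eq_right) (simp_all only: padic_abs_minus abs_theta_q Q)
  have f_x2: "potts_map \<theta> ?q x2 = x2"
    using den_x2 Q_pos assms by (intro potts_map_fixed_point not_pole) simp_all
  \<comment> \<open>Otherwise \<open>abs_denominator_far\<close> would make the denominator at
    \<open>x2\<close> larger than \<open>Q\<close>.\<close>
  have x2_1: "padic_abs (x2 - 1) \<le> padic_abs ?q"
    using abs_denominator_far[of x2] den_x2 by (cases "padic_abs (x2 - 1) > padic_abs ?q") simp_all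
  \<comment> \<open>At 1, numerator and denominator of \<open>g\<close> both equal
    \<open>\<theta> + ?q\<close>.\<close>
  have "\<theta> + ?q \<noteq> 0"
    using abs_theta_q q_nonzero by (metis padic_abs_eq_0)
  then have f_1: "potts_map \<theta> ?q 1 = 1"
    by (simp add: potts_map_def algebra_simps)
  have "padic_annulus (Q\<^sup>2) Q 1 \<subseteq> basin \<theta> ?q x1"
    using annulus_subset_basin[OF x1 f_x1 f_1] abs_theta_q Q_pos two Q by simp
  moreover have "padic_annulus (Q\<^sup>2) Q x2 \<subseteq> basin \<theta> ?q x1"
    using annulus_subset_basin[OF x1 f_x1 f_x2 assms(12) den_x2 x2_1 two] Q by simp
  \<comment> \<open>Points outside the closed unit ball belong to the far region.\<close>
  moreover have "{x. padic_abs x \<noteq> 1} \<subseteq> basin \<theta> ?q x1"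
    using unit_ball_subset_basin[OF x1 f_x1] far_subset_basin[OF x1 f_x1] abs_potts_map_outside(2)
    by (auto simp: neq_iff)
  moreover have "{x \<in> padic_sphere 1 0. padic_abs (x - 1) > Q} \<subseteq> basin \<theta> ?q x1"
    using far_subset_basin[OF x1 f_x1] Q by auto
  ultimately show ?thesis
    by (intro Un_least reaching_set_subset_basin)
qed

end
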